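(* Let $k,j\ge 1$ and let $\hat 0,\hat 1,b_1,\dots,b_k,c_1,\dots,c_j$ be distinct vertices. Let $Q$ be the acyclic quiver on these vertices with arcs $\hat 0\to b_1\to b_2\to\cdots\to b_k\to\hat 1$, $\hat 0\to c_1\to c_2\to\cdots\to c_j\to\hat 1$, and $\hat 0\to\hat 1$. Put $b_0=c_0=\hat 0$, $b_{k+1}=c_{j+1}=\hat 1$, $\mathbf{b}=(b_1,\dots,b_k)$, $\mathbf{c}=(c_1,\dots,c_j)$, $\mathrm{rev}(\mathbf{b})=(b_k,\dots,b_1)$. Then $$\Psi_{\rm tor}^{[Q]}(\mathbf{x})=\frac{(-1)^k}{\prod_{r=0}^{k}(x_{b_{r+1}}-x_{b_r})\cdot\prod_{s=0}^{j}(x_{c_s}-x_{c_{s+1}})},$$ or equivalently, $$\sum_{\mathbf{a}}\Psi_{\rm tor}^{[(\hat 1,\hat 0,\mathbf{a})]}(\mathbf{x})=(-1)^k\,\Psi_{\rm tor}^{[(\hat 1,\mathrm{rev}(\mathbf{b}),\hat 0,\mathbf{c})]}(\mathbf{x}),$$ where $\mathbf{a}$ ranges over the shuffle set of $\mathbf{b}$ and $\mathbf{c}$.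
   Context: The shuffle set of $\mathbf{b}=(b_1,\dots,b_k)$ and $\mathbf{c}=(c_1,\dots,c_j)$ is the set of all permutations of $(b_1,\dots,b_k,c_1,\dots,c_j)$ in which the $b_i$ appear in the same relative order as in $\mathbf{b}$ and the $c_i$ in the same relative order as in $\mathbf{c}$. All quivers are finite directed graphs that are simple (no loops, no parallel or anti-parallel arcs) and acyclic, on a finite vertex set $V$ with $|V|=n$. A source is a vertex all of whose incident arcs point away from it; a sink is a vertex all of whose incident arcs point into it (an isolated vertex is both). A flip at a source or sink $k$ reverses all arcs incident to $k$. Two acyclic quivers are equivalent if they are related by a finite sequence of flips; the equivalence class $[Q]$ of $Q$ is called a toric poset; all its members have the same underlying undirected graph. A toric total order $[w]=[(w_1,\dots,w_n)]$ is the equivalence class of a permutation $(w_1,\dots,w_n)$ of $V$ under cyclic rotation $(w_1,\dots,w_n)\mapsto(w_2,\dots,w_n,w_1)$. For a graph $G$ on $V$, let $\mathcal{A}_{\rm tor}(G)$ be the image in $\mathbb{R}^V/\mathbb{Z}^V$ of $\bigcup_{\{i,j\}\in G}\{x_i=x_j\}\subset\mathbb{R}^V$. A point of $\mathbb{R}^V/\mathbb{Z}^V-\mathcal{A}_{\rm tor}(G)$ determines an acyclic orientation of $G$: $i\to j$ if $x_i \bmod 1< x_j \bmod 1$ (values in $[0,1)$), and $j\to i$ otherwise. For a toric poset $[Q]$ with underlying graph $G$, its toric chamber $c_{[Q]}$ is the set of points whose orientation lies in $[Q]$ (these sets are exactly the connected components of $\mathbb{R}^V/\mathbb{Z}^V-\mathcal{A}_{\rm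 tor}(G)$). For a toric total order $[w]$, $c_{[w]}$ is the set of points with pairwise distinct coordinates such that listing the indices in increasing order of $x_i\bmod 1$ gives a member of $[w]$. $[w]$ is a toric total extension of $[Q]$ if $c_{[w]}\subseteq c_{[Q]}$; the set of these is $\mathcal{L}_{\rm tor}([Q])$. Define $\Psi_{\rm tor}^{[Q]}(\mathbf{x})=\sum_{[w]\in\mathcal{L}_{\rm tor}([Q])}\Psi_{\rm tor}^{[w]}(\mathbf{x})$, where $\Psi_{\rm tor}^{[w]}(\mathbf{x})=\dfrac{1}{(x_{w_1}-x_{w_2})(x_{w_2}-x_{w_3})\cdots(x_{w_{n-1}}-x_{w_n})(x_{w_n}-x_{w_1})}$ and $\mathbf{x}=(x_v)_{v\in V}$ are indeterminates. *)

theory Defs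
  imports
    "HOL-Analysis.Analysis"
    "HOL-Combinatorics.Multiset_Permutations"
    "HOL-Computational_Algebra.Fraction_Field"
    "HOL-Library.Poly_Mapping"
begin

section \<open>Acyclic quivers, flips and toric posets\<close>

text \<open>
  A quiver on the vertex set \<open>V\<close> is given by its set of arcs \<open>E\<close>.  Arcs form a set, so there are
  no parallel arcs; acyclicity (no directed cycle of any positive length) excludes loops and
  anti-parallel arcs.
\<close>

definition acyclic_quiver :: "'v set \<Rightarrow> 'v rel \<Rightarrow> bool" where
  "acyclic_quiver V E \<longleftrightarrow> finite V \<and> E \<subseteq> V \<times> V \<and> acyclic E"

definition is_source :: "'v rel \<Rightarrow> 'v \<Rightarrow> bool" where
  "is_source E k \<longleftrightarrow> (\<forall>u. (u, k) \<notin> E)"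

definition is_sink :: "'v rel \<Rightarrow> 'v \<Rightarrow> bool" where
  "is_sink E k \<longleftrightarrow> (\<forall>u. (k, u) \<notin> E)"

definition flip :: "'v \<Rightarrow> 'v rel \<Rightarrow> 'v rel" where
  "flip k E = {(u, v). (if u = k \<or> v = k then (v, u) \<in> E else (u, v) \<in> E)}"

definition flip_step :: "'v set \<Rightarrow> 'v rel \<Rightarrow> 'v rel \<Rightarrow> bool" where
  "flip_step V E E' \<longleftrightarrow> (\<exists>k\<in>V. (is_source E k \<or> is_sink E k) \<and> E' = flip k E)"

definition toric_equiv :: "'v set \<Rightarrow> 'v rel rel" where
  "toric_equiv V =
     {(E, E'). acyclic_quiver V E \<and> acyclic_quiver V E' \<and> (flip_step V)\<^sup>*\<^sup>* E E'}"

definition toric_poset :: "'v set \<Rightarrow> 'v rel \<Rightarrow> 'v rel set" where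
  "toric_poset V Q = toric_equiv V `` {Q}"

definition underlying_graph :: "'v rel \<Rightarrow> 'v set set" where
  "underlying_graph E = {{u, v} | u v. (u, v) \<in> E}"

text \<open>
  Here and below, \<^const>\<open>the_elem\<close> is applied to singleton sets: it yields the common value
  of a function on all members of a class (see the lemmas at the end).
\<close>

definition toric_graph :: "'v rel set \<Rightarrow> 'v set set" where
  "toric_graph P = the_elem (underlying_graph ` P)"


section \<open>The torus, toric arrangements and toric chambers\<close>

text \<open>
  The space of real vectors indexed by \<open>V\<close> is rendered as the set of functions that are
  \<^const>\<open>undefined\<close> outside \<open>V\<close>, and a point of the torus is a coset of the integer vectors.
\<close>

definition integer_shift :: "'v set \<Rightarrow> ('v \<Rightarrow> real) rel" where
  "integer_shift V =
     {(x, y). x \<in> (V \<rightarrow>\<^sub>E UNIV) \<and> y \<in> (V \<rightarrow>\<^sub>E UNIV) \<and> (\<forall>v\<in>V. x v - y v \<in> \<int>)}"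

definition torus :: "'v set \<Rightarrow> ('v \<Rightarrow> real) set set" where
  "torus V = (V \<rightarrow>\<^sub>E UNIV) // integer_shift V"

definition torus_proj :: "'v set \<Rightarrow> ('v \<Rightarrow> real) \<Rightarrow> ('v \<Rightarrow> real) set" where
  "torus_proj V x = integer_shift V `` {x}"

definition toric_arrangement :: "'v set \<Rightarrow> 'v set set \<Rightarrow> ('v \<Rightarrow> real) set set" where
  "toric_arrangement V G =
     torus_proj V ` (\<Union>(i, j)\<in>{(i, j). {i, j} \<in> G}. {x \<in> V \<rightarrow>\<^sub>E UNIV. x i = x j})"

definition coord :: "('v \<Rightarrow> real) set \<Rightarrow> 'v \<Rightarrow> real" where
  "coord p v = the_elem ((\<lambda>x. frac (x v)) ` p)"

definition orientation_at :: "'v set set \<Rightarrow> ('v \<Rightarrow> real) set \<Rightarrow> 'v rel" where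
  "orientation_at G p = {(i, j). {i, j} \<in> G \<and> coord p i < coord p j}"

definition toric_chamber :: "'v set \<Rightarrow> 'v rel set \<Rightarrow> ('v \<Rightarrow> real) set set" where
  "toric_chamber V P =
     {p \<in> torus V - toric_arrangement V (toric_graph P). orientation_at (toric_graph P) p \<in> P}"


section \<open>Toric total orders and toric total extensions\<close>

definition toric_order :: "'v list \<Rightarrow> 'v list set" where
  "toric_order w = {rotate m w | m. True}"

definition toric_total_orders :: "'v set \<Rightarrow> 'v list set set" where
  "toric_total_orders V = toric_order ` permutations_of_set V"

definition total_order_chamber :: "'v set \<Rightarrow> 'v list set \<Rightarrow> ('v \<Rightarrow> real) set set" where
  "total_order_chamber V W =
     {p \<in> torus V. inj_on (coord p) V \<and>
        (\<exists>u \<in> permutations_of_set V. sorted_wrt (\<lambda>i j. coord p i < coord p j) u \<and> u \<in> W)}"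

definition toric_total_extensions :: "'v set \<Rightarrow> 'v rel set \<Rightarrow> 'v list set set" where
  "toric_total_extensions V P =
     {W \<in> toric_total_orders V. total_order_chamber V W \<subseteq> toric_chamber V P}"


section \<open>The rational functions\<close>

text \<open>
  The field of rational functions over \<open>'k\<close> in indeterminates indexed by \<open>'v\<close> is the fraction
  field of the polynomial ring, whose elements are finitely supported maps from monomials
  (exponent vectors) to coefficients.  The linear order on \<open>'v\<close> is only needed for the library's
  proof that this ring is an integral domain.
\<close>

type_synonym ('v, 'k) ratfun = "(('v \<Rightarrow>\<^sub>0 nat) \<Rightarrow>\<^sub>0 'k) fract"

definition indet :: "'v::linorder \<Rightarrow> ('v, 'k::field) ratfun" where
  "indet v = Fract (Poly_Mapping.single (Poly_Mapping.single v 1) 1) 1"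

definition psi_word :: "('v \<Rightarrow> 'f::field) \<Rightarrow> 'v list \<Rightarrow> 'f" where
  "psi_word x w = 1 / (\<Prod>i<length w. (x (w ! i) - x (w ! (Suc i mod length w))))"

definition psi_tor_order :: "('v \<Rightarrow> 'f::field) \<Rightarrow> 'v list set \<Rightarrow> 'f" where
  "psi_tor_order x W = the_elem (psi_word x ` W)"

definition psi_tor :: "('v \<Rightarrow> 'f::field) \<Rightarrow> 'v set \<Rightarrow> 'v rel set \<Rightarrow> 'f" where
  "psi_tor x V P = (\<Sum>W\<in>toric_total_extensions V P. psi_tor_order x W)"


section \<open>Independence of representatives\<close>

lemma underlying_graph_flip:
  fixes E :: "'v rel"
  shows "underlying_graph (flip k E) = underlying_graph E"
proof -
  have mem: "{u, v} \<in> underlying_graph A \<longleftrightarrow> (u, v) \<in> A \<or> (v, u) \<in> A" for u v :: 'v and A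
    by (auto simp: underlying_graph_def doubleton_eq_iff)
  have "\<exists>u v. e = {u, v}" if "e \<in> underlying_graph A" for e and A :: "'v rel"
    using that by (auto simp: underlying_graph_def)
  moreover have "{u, v} \<in> underlying_graph (flip k E) \<longleftrightarrow> {u, v} \<in> underlying_graph E" for u v
    unfolding mem by (auto simp: flip_def)
  ultimately show ?thesis
    by (intro set_eqI) metis
qed

lemma toric_graph_eq:
  assumes "acyclic_quiver V Q"
  shows "toric_graph (toric_poset V Q) = underlying_graph Q"
  unfolding toric_graph_def
proof (rule the_elem_image_unique)
  show "toric_poset V Q \<noteq> {}"
    using assms unfolding toric_poset_def toric_equiv_def by blast
  fix E'
  assume "E' \<in> toric_poset V Q"
  then have "(flip_step V)\<^sup>*\<^sup>* Q E'"
    by (simp add: toric_poset_def toric_equiv_def)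
  then show "underlying_graph E' = underlying_graph Q"
  proof (induction rule: rtranclp_induct)
    case (step E' E'')
    then show ?case
      by (metis flip_step_def underlying_graph_flip)
  qed simp
qed

lemma flip_step_sym: "flip_step V E E' \<Longrightarrow> flip_step V E' E"
proof -
  assume "flip_step V E E'"
  then obtain k where k: "k \<in> V" "is_source E k \<or> is_sink E k" "E' = flip k E"
    by (auto simp: flip_step_def)
  have "E = flip k E'"
    unfolding k(3) flip_def by (auto split: if_splits)
  moreover have "is_source E' k \<or> is_sink E' k"
    using k(2) unfolding k(3) by (auto simp: is_source_def is_sink_def flip_def)
  ultimately show ?thesis
    using k(1) unfolding flip_step_def by blast
qed

lemma equiv_toric_equiv: "equiv (Collect (acyclic_quiver V)) (toric_equiv V)"
proof (rule equivI)
  have "(flip_step V)\<^sup>*\<^sup>* E' E" if "(flip_step V)\<^sup>*\<^sup>* E E'" for E E'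
    using that by induction (auto intro: flip_step_sym converse_rtranclp_into_rtranclp)
  then show "sym (toric_equiv V)"
    unfolding sym_def toric_equiv_def by blast
  show "trans (toric_equiv V)"
    unfolding trans_def toric_equiv_def by (blast intro: rtranclp_trans)
  show "refl_on (Collect (acyclic_quiver V)) (toric_equiv V)"
    unfolding refl_on_def toric_equiv_def by blast
  show "toric_equiv V \<subseteq> Collect (acyclic_quiver V) \<times> Collect (acyclic_quiver V)"
    unfolding toric_equiv_def by blast
qed

lemma coord_torus_proj:
  assumes "x \<in> V \<rightarrow>\<^sub>E UNIV" "v \<in> V"
  shows "coord (torus_proj V x) v = frac (x v)"
proof -
  have "frac (y v) = frac (x v)" if "y \<in> torus_proj V x" for y
  proof -
    have "x v - y v \<in> \<int>"
      using that assms by (auto simp: torus_proj_def integer_shift_def)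
    then obtain n where "x v - y v = of_int n"
      by (elim Ints_cases)
    then have "x v = y v + of_int n"
      by simp
    then show ?thesis
      by (simp add: frac_def)
  qed
  moreover have "x \<in> torus_proj V x"
    using assms by (auto simp: torus_proj_def integer_shift_def)
  ultimately show ?thesis
    unfolding coord_def by (blast intro: the_elem_image_unique)
qed

lemma psi_word_rotate1: "psi_word x (rotate1 w) = psi_word x w"
proof (cases "w = []")
  case False
  define n where "n = length w"
  have n: "n > 0" using False by (simp add: n_def)
  define g where "g i = x (w ! i) - x (w ! (Suc i mod n))" for i
  have "(\<Prod>i<n. (x (rotate1 w ! i) - x (rotate1 w ! (Suc i mod n)))) = (\<Prod>i<n. g (Suc i mod n))"
    using n by (intro prod.cong) (auto simp: nth_rotate1 g_def n_def)
  also have "\<dots> = (\<Prod>i<n. g i)"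
  proof (rule prod.reindex_bij_betw)
    have "inj_on (\<lambda>i. Suc i mod n) {..<n}"
      by (auto simp: inj_on_def mod_Suc split: if_splits)
    moreover have "(\<lambda>i. Suc i mod n) ` {..<n} \<subseteq> {..<n}"
      using n by auto
    ultimately show "bij_betw (\<lambda>i. Suc i mod n) {..<n} {..<n}"
      by (simp add: bij_betw_def endo_inj_surj)
  qed
  finally show ?thesis
    by (simp add: psi_word_def n_def g_def)
qed simp

lemma psi_tor_order_eq: "psi_tor_order x (toric_order w) = psi_word x w"
proof -
  have "psi_word x (rotate m w) = psi_word x w" for m
    by (induction m) (simp_all add: psi_word_rotate1)
  moreover have "w \<in> toric_order w"
    unfolding toric_order_def by (auto intro: exI[of _ 0])
  ultimately show ?thesis
    unfolding psi_tor_order_def toric_order_def by (blast intro: the_elem_image_unique)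
qed

end

theory Submission
  imports Defs
begin

text \<open>
  The toric total extensions of \<open>[Q]\<close> are the classes of \<open>(z0, a, z1)\<close> with \<open>a\<close> a shuffle: rotating
  such a word flips a source, so all its rotations induce orientations in \<open>[Q]\<close>.  Conversely, every
  member of \<open>[Q]\<close> differs from \<open>Q\<close> by the coboundary of an integer potential that is monotone along
  the arcs of \<open>Q\<close>; if the word starts with \<open>z0\<close>, the arc \<open>z0 \<rightarrow> z1\<close> is not reversed, so the potential
  is constant and the word is a linear extension of \<open>Q\<close>.  With \<open>P(z, b, y)\<close> the product of consecutive
  differences along \<open>z, b, y\<close>, the sum over shuffles of \<open>1 / P(z, a, y)\<close> equals
  \<open>(x z - x y) / (P(z, b, y) P(z, c, y))\<close>, by induction on the first letter of the shuffle.
\<close>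

section \<open>The shuffle identity\<close>

text \<open>The denominator of \<open>psi_word\<close> without the factor that closes the cycle.
  This open form can be cut at any letter and loses one factor with its first letter.\<close>

definition path_prod :: "('v \<Rightarrow> 'f::field) \<Rightarrow> 'v list \<Rightarrow> 'f" where
  "path_prod x w = (\<Prod>i<length w - 1. (x (w ! i) - x (w ! Suc i)))"

lemma path_prod_Nil [simp]: "path_prod x [] = 1"
  by (simp add: path_prod_def)

lemma path_prod_single [simp]: "path_prod x [a] = 1"
  by (simp add: path_prod_def)

lemma path_prod_Cons_Cons [simp]:
  "path_prod x (a # b # w) = (x a - x b) * path_prod x (b # w)"
  by (simp add: path_prod_def prod.lessThan_Suc_shift del: prod.lessThan_Suc)

text \<open>The letter \<open>y\<close> ends the first path and starts the second, so no factor is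
  lost at the cut.\<close>

lemma path_prod_append: "path_prod x (u @ y # w) = path_prod x (u @ [y]) * path_prod x (y # w)"
  by (induction u rule: induct_list012) simp_all

text \<open>Each of the \<open>length w - 1\<close> factors changes sign.\<close>

lemma path_prod_rev: "path_prod x (rev w) = (-1) ^ (length w - 1) * path_prod x w"
proof (induction w rule: induct_list012)
  case (3 a b w)
  have "path_prod x (rev (a # b # w)) = path_prod x (rev (b # w)) * (x b - x a)"
    using path_prod_append[of x "rev w" b "[a]"] by simp
  then show ?case
    using 3 by (simp add: algebra_simps)
qed (simp_all add: path_prod_def)

lemma path_prod_nonzero:
  assumes "inj_on x (set w)" "distinct w"
  shows "path_prod x w \<noteq> 0"
  using assms
  by (induction w rule: induct_list012) (auto simp: inj_on_def)

lemma psi_word_eq_path_prod: "psi_word x (a # w) = 1 / path_prod x (a # w @ [a])"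
proof -
  have "(\<Prod>i<length (a # w). (x ((a # w) ! i) - x ((a # w) ! (Suc i mod length (a # w)))))
      = path_prod x (a # w @ [a])"
    unfolding path_prod_def
  proof (rule prod.cong)
    fix i assume "i \<in> {..<length (a # w @ [a]) - 1}"
    then have "i \<le> length w" by simp
    then have "(a # w) ! i = (a # w @ [a]) ! i"
      by (simp add: nth_Cons nth_append split: nat.splits)
    \<comment> \<open>The index wraps to 0 only at \<open>i = length w\<close>, where the appended
      copy of \<open>a\<close> stands.\<close>
    moreover have "(a # w) ! (Suc i mod length (a # w)) = (a # w @ [a]) ! Suc i"
      using \<open>i \<le> length w\<close> by (cases "i = length w") (simp_all add: nth_append)
    ultimately show "x ((a # w) ! i) - x ((a # w) ! (Suc i mod length (a # w)))
        = x ((a # w @ [a]) ! i) - x ((a # w @ [a]) ! Suc i)"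
      by simp
  qed simp
  then show ?thesis
    by (simp add: psi_word_def)
qed

text \<open>A shuffle starts with the first letter \<open>p\<close> of \<open>b\<close> or
  \<open>q\<close> of \<open>c\<close>. The induction hypothesis, with that letter in place of
  \<open>z\<close>, reduces the claim to \<open>(p - y) / ((p - q) * (z - p)) + (q - y) / ((q - p) *
  (z - q)) = (z - y) / ((z - p) * (z - q))\<close>, letters standing for their values under
  \<open>x\<close>.\<close>

lemma sum_shuffles_path_prod:
  fixes x :: "'v \<Rightarrow> 'f::field"
  assumes "distinct (z # y # b @ c)" "inj_on x (set (z # y # b @ c))"
  shows "(\<Sum>a\<in>shuffles b c. 1 / path_prod x (z # a @ [y]))
       = (x z - x y) / (path_prod x (z # b @ [y]) * path_prod x (z # c @ [y]))"
  using assms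
proof (induction b c arbitrary: z rule: shuffles.induct)
  case (3 b1 b c1 c)
  have dist: "b1 \<noteq> c1" "z \<noteq> b1" "z \<noteq> c1" using 3 by auto
  let ?B = "path_prod x (b1 # b @ [y])" and ?C = "path_prod x (c1 # c @ [y])"
  let ?p = "x b1" and ?q = "x c1"
  have ne: "?p - ?q \<noteq> 0" "?q - ?p \<noteq> 0" "x z - ?p \<noteq> 0" "x z - ?q \<noteq> 0"
    using dist "3.prems"(2) by (auto simp: inj_on_def)
  have ne2: "?B \<noteq> 0" "?C \<noteq> 0"
    using "3.prems" by (intro path_prod_nonzero; auto simp: inj_on_def)+
  have "(\<Sum>a\<in>shuffles (b1 # b) (c1 # c). 1 / path_prod x (z # a @ [y]))
     = (\<Sum>a\<in>(#) b1 ` shuffles b (c1 # c). 1 / path_prod x (z # a @ [y]))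
     + (\<Sum>a\<in>(#) c1 ` shuffles (b1 # b) c. 1 / path_prod x (z # a @ [y]))"
    using dist by (auto intro!: sum.union_disjoint)
  also have "\<dots> = (\<Sum>a\<in>shuffles b (c1 # c). 1 / path_prod x (b1 # a @ [y])) / (x z - ?p)
     + (\<Sum>a\<in>shuffles (b1 # b) c. 1 / path_prod x (c1 # a @ [y])) / (x z - ?q)"
    by (simp add: sum.reindex sum_divide_distrib mult.commute)
  also have "(\<Sum>a\<in>shuffles b (c1 # c). 1 / path_prod x (b1 # a @ [y]))
      = (?p - x y) / (?B * ((?p - ?q) * ?C))"
    using "3.IH"(1)[of b1] "3.prems" by (auto simp: inj_on_def)
  also have "(\<Sum>a\<in>shuffles (b1 # b) c. 1 / path_prod x (c1 # a @ [y]))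
      = (?q - x y) / (((?q - ?p) * ?B) * ?C)"
    using "3.IH"(2)[of c1] "3.prems" by (auto simp: inj_on_def)
  also have "(?p - x y) / (?B * ((?p - ?q) * ?C)) / (x z - ?p)
      + (?q - x y) / (((?q - ?p) * ?B) * ?C) / (x z - ?q)
      = (x z - x y) / (((x z - ?p) * ?B) * ((x z - ?q) * ?C))"
  proof -
    have "(?q - x y) / (((?q - ?p) * ?B) * ?C) = - ((?q - x y) / (((?p - ?q) * ?B) * ?C))"
      using ne ne2 by (simp add: divide_simps) (simp add: algebra_simps)
    then show ?thesis
      using ne ne2 by (simp add: divide_simps) (simp add: algebra_simps)
  qed
  finally show ?case by simp
next
  case (1 ys)
  \<comment> \<open>With one list empty, its path has the single factor \<open>x z - x y\<close>,
    which cancels the numerator.\<close>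
  then have "x z - x y \<noteq> 0" by (auto simp: inj_on_def)
  then show ?case by simp
next
  case (2 xs)
  then have "x z - x y \<noteq> 0" by (auto simp: inj_on_def)
  then show ?case by simp
qed

text \<open>Ensures that differences of indeterminates at distinct vertices do not vanish in
  denominators.\<close>

lemma inj_indet: "inj (indet :: 'v::linorder \<Rightarrow> ('v, 'k::field) ratfun)"
proof (rule injI)
  fix u v :: 'v
  assume "(indet u :: ('v, 'k) ratfun) = indet v"
  then have "Poly_Mapping.single (Poly_Mapping.single u (1::nat)) (1::'k)
      = Poly_Mapping.single (Poly_Mapping.single v 1) 1"
    by (simp add: indet_def eq_fract)
  \<comment> \<open>If the monomials differed, the coefficient at one of them would be both 1 and 0.
    Exponents are then compared in the same way.\<close>
  then have "Poly_Mapping.single u (1::nat) = Poly_Mapping.single v 1"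
    by (metis lookup_single_eq lookup_single_not_eq one_neq_zero)
  then show "u = v"
    by (metis lookup_single_eq lookup_single_not_eq one_neq_zero)
qed

section \<open>Orientations of a graph by a height\<close>

text \<open>Heights are arbitrary reals rather than torus coordinates in \<open>[0,1)\<close>, so
  that a vertex can be pushed below all others.\<close>

definition orient :: "'v set set \<Rightarrow> ('v \<Rightarrow> real) \<Rightarrow> 'v rel" where
  "orient G f = {(i, j). {i, j} \<in> G \<and> f i < f j}"

lemma orientation_at_eq: "orientation_at G p = orient G (coord p)"
  by (simp add: orientation_at_def orient_def)

lemma mem_underlying_graph: "{u, v} \<in> underlying_graph E \<longleftrightarrow> (u, v) \<in> E \<or> (v, u) \<in> E"
  by (auto simp: underlying_graph_def doubleton_eq_iff)

lemma acyclic_orient: "acyclic (orient G f)"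
proof -
  have "f i < f j" if "(i, j) \<in> (orient G f)\<^sup>+" for i j
    using that by induction (auto simp: orient_def)
  then show ?thesis
    unfolding acyclic_def by blast
qed

lemma acyclic_quiver_orient:
  assumes "acyclic_quiver V Q"
  shows "acyclic_quiver V (orient (underlying_graph Q) f)"
  using assms acyclic_orient[of "underlying_graph Q" f]
  unfolding acyclic_quiver_def by (auto simp: orient_def mem_underlying_graph)

lemma orient_eq_quiver:
  assumes "\<And>u v. (u, v) \<in> Q \<Longrightarrow> f u < f v"
  shows "orient (underlying_graph Q) f = Q"
  using assms by (auto simp: orient_def mem_underlying_graph dest: less_asym)

text \<open>Moving the first entry of a word to the end flips a source.\<close>

lemma orient_rotate_in_toric_poset:
  assumes acyc: "acyclic_quiver V Q"
    and w: "set w = V" "distinct w"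
    and base: "\<And>f. sorted_wrt (\<lambda>i j. f i < f j) w \<Longrightarrow> orient (underlying_graph Q) f = Q"
    and "sorted_wrt (\<lambda>i j. f i < f j) (rotate m w)"
  shows "orient (underlying_graph Q) f \<in> toric_poset V Q"
  using assms(5)
proof (induction m arbitrary: f)
  case 0
  then show ?case
    using base acyc by (simp add: toric_poset_def toric_equiv_def)
next
  case (Suc m)
  let ?G = "underlying_graph Q"
  show ?case
  proof (cases "rotate m w")
    case Nil
    then have "w = []" by simp
    then have "orient ?G f = Q" using base[of f] by simp
    then show ?thesis using acyc by (simp add: toric_poset_def toric_equiv_def)
  next
    case (Cons v vs)
    have dist: "distinct (v # vs)" and set: "set (v # vs) = V"
      using w by (simp_all flip: Cons)
    have srt: "sorted_wrt (\<lambda>i j. f i < f j) (vs @ [v])"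
      using Suc.prems Cons by simp
    \<comment> \<open>Lowering \<open>v\<close> below every vertex undoes the last rotation:
      \<open>f'\<close> sorts \<open>v # vs\<close>, and all other heights stay the same.\<close>
    define f' where "f' = f(v := Min (f ` V) - 1)"
    have fin: "finite V" using set by auto
    have f'v: "f' v < f' i" if "i \<in> V" "i \<noteq> v" for i
    proof -
      have "Min (f ` V) \<le> f i" using that fin by simp
      then show ?thesis using that by (simp add: f'_def)
    qed
    have "sorted_wrt (\<lambda>i j. f' i < f' j) vs"
      using srt dist by (auto simp: sorted_wrt_append f'_def intro: sorted_wrt_mono_rel[rotated])
    then have "sorted_wrt (\<lambda>i j. f' i < f' j) (v # vs)"
      using f'v dist set by auto
    then have IH: "orient ?G f' \<in> toric_poset V Q"
      using Suc.IH Cons by simp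
    have GV: "i \<in> V \<and> j \<in> V \<and> i \<noteq> j" if "{i, j} \<in> ?G" for i j
      using that acyc unfolding acyclic_quiver_def acyclic_def mem_underlying_graph by blast
    have fv: "f i < f v" if "i \<in> V" "i \<noteq> v" for i
      using that srt set by (auto simp: sorted_wrt_append)
    have src: "is_source (orient ?G f') v"
      unfolding is_source_def orient_def using f'v GV by (auto dest: less_asym)
    \<comment> \<open>The vertex \<open>v\<close> is lowest for \<open>f'\<close> and highest for
      \<open>f\<close>, so exactly the edges at \<open>v\<close> change direction.\<close>
    have "orient ?G f = flip v (orient ?G f')"
    proof -
      have "(i, j) \<in> orient ?G f \<longleftrightarrow> (i, j) \<in> flip v (orient ?G f')" for i j
      proof (cases "{i, j} \<in> ?G")
        case True
        then have "{j, i} \<in> ?G" by (simp add: insert_commute)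
        consider "i = v" "j \<noteq> v" | "i \<noteq> v" "j = v" | "i \<noteq> v" "j \<noteq> v"
          using GV[OF True] by auto
        then show ?thesis
          using GV[OF True] fv[of i] fv[of j] f'v[of i] f'v[of j] True \<open>{j, i} \<in> ?G\<close>
          by cases (auto simp: flip_def orient_def f'_def)
      next
        case False
        then have "{j, i} \<notin> ?G" by (simp add: insert_commute)
        with False show ?thesis by (auto simp: flip_def orient_def)
      qed
      then show ?thesis by auto
    qed
    then have "flip_step V (orient ?G f') (orient ?G f)"
      unfolding flip_step_def using src set by auto
    with IH show ?thesis
      using acyclic_quiver_orient[OF acyc]
      unfolding toric_poset_def toric_equiv_def
      by (auto intro: rtranclp.rtrancl_into_rtrancl)
  qed
qed

text \<open>\<open>h\<close> counts the flips at each vertex, source flips with sign \<open>+1\<close> and sink flips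
  with sign \<open>-1\<close>.\<close>

lemma toric_poset_potential:
  fixes Q :: "'v rel"
  assumes "acyclic_quiver V Q" "E \<in> toric_poset V Q"
  obtains h :: "'v \<Rightarrow> int" where
    "\<And>u v. (u, v) \<in> Q \<Longrightarrow> ((u, v) \<in> E \<and> h v = h u) \<or> ((v, u) \<in> E \<and> h v = h u - 1)"
proof -
  have irr: "u \<noteq> v" if "(u, v) \<in> Q" for u v
    using that assms(1) unfolding acyclic_quiver_def acyclic_def by blast
  have "(flip_step V)\<^sup>*\<^sup>* Q E"
    using assms(2) by (simp add: toric_poset_def toric_equiv_def)
  then have "\<exists>h :: 'v \<Rightarrow> int. \<forall>u v. (u, v) \<in> Q \<longrightarrow>
      ((u, v) \<in> E \<and> h v = h u) \<or> ((v, u) \<in> E \<and> h v = h u - 1)"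
  proof (induction rule: rtranclp_induct)
    case base
    show ?case by (rule exI[of _ "\<lambda>_. 0"]) simp
  next
    case (step E E')
    then obtain h :: "'v \<Rightarrow> int" where h: "\<And>u v. (u, v) \<in> Q \<Longrightarrow>
        ((u, v) \<in> E \<and> h v = h u) \<or> ((v, u) \<in> E \<and> h v = h u - 1)"
      by blast
    from step.hyps(2) obtain k where k: "is_source E k \<or> is_sink E k" "E' = flip k E"
      by (auto simp: flip_step_def)
    \<comment> \<open>At a source \<open>k\<close>, arcs of \<open>Q\<close> leaving
      \<open>k\<close> agree with \<open>E\<close> and get reversed, while those entering
      \<open>k\<close> are reversed in \<open>E\<close> and get restored; raising \<open>h k\<close>
      by 1 accounts for both. A sink is dual.\<close>
    define d :: int where "d = (if is_source E k then 1 else -1)"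
    have "((u, v) \<in> E' \<and> (h(k := h k + d)) v = (h(k := h k + d)) u) \<or>
        ((v, u) \<in> E' \<and> (h(k := h k + d)) v = (h(k := h k + d)) u - 1)" if "(u, v) \<in> Q" for u v
      using h[OF that] irr[OF that] k
      by (auto simp: flip_def d_def is_source_def is_sink_def split: if_splits)
    then show ?case by blast
  qed
  then show thesis using that by blast
qed


section \<open>Toric total extensions of the double chain\<close>

lemma toric_order_rotate: "toric_order (rotate m w) = toric_order w"
proof -
  \<comment> \<open>Rotating back by \<open>m\<close> is written as
    \<open>m * (length w - 1)\<close> forward rotations, which is the same modulo the
    length.\<close>
  have "rotate i w = rotate (i + m * (length w - 1)) (rotate m w)" for i
  proof (cases "w = []")
    case False
    then have "i + m * (length w - 1) + m = i + m * length w"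
      by (cases w) simp_all
    then have "rotate (i + m * (length w - 1)) (rotate m w) = rotate (i + m * length w) w"
      by (simp only: rotate_rotate)
    also have "\<dots> = rotate i w"
      by (metis mod_mult_self1 rotate_conv_mod)
    finally show ?thesis by simp
  qed simp
  then show ?thesis
    unfolding toric_order_def by (auto simp: rotate_rotate)
qed

lemma toric_order_Cons: "toric_order (v # w) = toric_order (w @ [v])"
  using toric_order_rotate[of 1 "v # w"] by simp

lemma toric_order_self: "w \<in> toric_order w"
  unfolding toric_order_def by (auto intro: exI[of _ 0])

text \<open>Each letter of a distinct word heads exactly one of its rotations. This separates the
  classes of different shuffles.\<close>

lemma toric_order_Cons_eqD:
  assumes "distinct (v # w)" "toric_order (v # w) = toric_order (v # w')"
  shows "w' = w"
proof -
  from assms(2) have "v # w' \<in> toric_order (v # w)"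
    using toric_order_self by blast
  then obtain m where m: "v # w' = rotate m (v # w)"
    by (auto simp: toric_order_def)
  define r where "r = m mod length (v # w)"
  have r: "r < length (v # w)" unfolding r_def by (rule mod_less_divisor) simp
  have "v # w' = rotate r (v # w)" using m rotate_conv_mod[of m "v # w"] by (simp add: r_def)
  moreover from this have "(v # w) ! r = (v # w) ! 0"
    using r hd_rotate_conv_nth[of "v # w" r] by (metis list.distinct(1) list.sel(1) mod_less nth_Cons_0)
  then have "r = 0"
    using r assms(1) by (metis length_greater_0_conv list.distinct(1) nth_eq_iff_index_eq)
  ultimately show ?thesis by simp
qed

text \<open>Strictly increasing heights determine a word from its set of letters; this recovers
  \<open>b\<close> and \<open>c\<close> inside a longer word.\<close>

lemma sorted_wrt_filter_eq:
  fixes f :: "'v \<Rightarrow> real"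
  assumes "sorted_wrt (\<lambda>i j. f i < f j) u" "sorted_wrt (\<lambda>i j. f i < f j) w" "set w \<subseteq> set u"
  shows "filter (\<lambda>v. v \<in> set w) u = w"
proof -
  have inj: "inj_on f (set u)"
  proof -
    have "distinct (map f u)"
      using assms(1) by (simp add: strict_sorted_iff flip: sorted_wrt_map)
    then show ?thesis by (simp add: distinct_map)
  qed
  have "sorted_wrt (<) (map f (filter (\<lambda>v. v \<in> set w) u))" "sorted_wrt (<) (map f w)"
    using assms by (simp_all add: sorted_wrt_map sorted_wrt_filter)
  moreover have "set (filter (\<lambda>v. v \<in> set w) u) = set w"
    using assms(3) by auto
  ultimately have "map f (filter (\<lambda>v. v \<in> set w) u) = map f w"
    by (intro strict_sorted_equal) (simp_all only: set_map)
  then show ?thesis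
    using inj assms(3) by (elim map_inj_on) (auto intro: inj_on_subset)
qed

text \<open>The height is the position divided by the length. Values in \<open>[0,1)\<close> are
  their own fractional parts, so they can serve as torus coordinates.\<close>

lemma obtain_increasing:
  assumes "distinct u"
  obtains f :: "'v \<Rightarrow> real" where
    "sorted_wrt (\<lambda>i j. f i < f j) u" "\<And>v. v \<in> set u \<Longrightarrow> 0 \<le> f v \<and> f v < 1"
proof
  define f where "f v = real (inv_into {..<length u} ((!) u) v) / real (length u)" for v
  have f: "f (u ! i) = real i / real (length u)" if "i < length u" for i
    using that assms by (simp add: f_def inv_into_f_f inj_on_nth)
  show "sorted_wrt (\<lambda>i j. f i < f j) u"
    unfolding sorted_wrt_iff_nth_less
    by (auto simp: f intro!: divide_strict_right_mono)
  show "0 \<le> f v \<and> f v < 1" if "v \<in> set u" for v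
    using that by (auto simp: in_set_conv_nth f divide_less_eq)
qed

definition path_arcs :: "'v list \<Rightarrow> 'v rel" where
  "path_arcs w = {(w ! r, w ! Suc r) | r. Suc r < length w}"

text \<open>By transitivity consecutive entries suffice. Applied to \<open><\<close> on heights and
  to \<open>\<ge>\<close> on potentials.\<close>

lemma sorted_wrt_iff_path_arcs:
  assumes "transp R"
  shows "sorted_wrt R w \<longleftrightarrow> (\<forall>(u, v)\<in>path_arcs w. R u v)"
  using assms by (auto simp: sorted_wrt_iff_nth_Suc_transp path_arcs_def)

lemma path_arcs_subset: "path_arcs w \<subseteq> set w \<times> set w"
  by (auto simp: path_arcs_def)

section \<open>The double chain and its linear extensions\<close>

locale double_chain =
  fixes z0 z1 :: 'v and b c :: "'v list" and V Q
  assumes dist: "distinct (z0 # z1 # b @ c)"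
    and V_def: "V = set (z0 # z1 # b @ c)"
    and Q_def: "Q = path_arcs (z0 # b @ [z1]) \<union> path_arcs (z0 # c @ [z1]) \<union> {(z0, z1)}"
begin

text \<open>Heights rise from \<open>z0\<close> to \<open>z1\<close> along the chain through
  \<open>b\<close>, which settles the arc \<open>(z0, z1)\<close>.\<close>

lemma increasing_iff:
  fixes f :: "'v \<Rightarrow> real"
  shows "(\<forall>(u, v)\<in>Q. f u < f v) \<longleftrightarrow>
    sorted_wrt (\<lambda>i j. f i < f j) (z0 # b @ [z1]) \<and> sorted_wrt (\<lambda>i j. f i < f j) (z0 # c @ [z1])"
proof -
  have *: "sorted_wrt (\<lambda>i j. f i < f j) w \<longleftrightarrow> (\<forall>(u, v)\<in>path_arcs w. f u < f v)" for w
    by (intro sorted_wrt_iff_path_arcs) (auto intro: transpI)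
  have "f z0 < f z1" if "sorted_wrt (\<lambda>i j. f i < f j) (z0 # b @ [z1])"
    using that by simp
  then show ?thesis
    unfolding Q_def using *[of "z0 # b @ [z1]"] *[of "z0 # c @ [z1]"] by blast
qed

text \<open>As \<open>b\<close> and \<open>c\<close> are disjoint, each is a filter of
  \<open>a\<close> and inherits its sortedness.\<close>

lemma shuffle_increasing:
  fixes f :: "'v \<Rightarrow> real"
  assumes a: "a \<in> shuffles b c" and srt: "sorted_wrt (\<lambda>i j. f i < f j) (z0 # a @ [z1])"
  shows "\<forall>(u, v)\<in>Q. f u < f v"
proof -
  have disj: "set b \<inter> set c = {}" using dist by auto
  have "sorted_wrt (\<lambda>i j. f i < f j) b" "sorted_wrt (\<lambda>i j. f i < f j) c"
    using srt sorted_wrt_filter[of "\<lambda>i j. f i < f j" a]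
      filter_shuffles_disjoint1(1)[OF disj a] filter_shuffles_disjoint2(1)[OF disj a]
    by (metis sorted_wrt.simps(2) sorted_wrt_append)+
  then show ?thesis
    unfolding increasing_iff using srt set_shuffles[OF a] by (auto simp: sorted_wrt_append)
qed

text \<open>Heights increasing along \<open>z0, b, c, z1\<close> exhibit \<open>Q\<close> as an
  \<open>orient\<close>, and these are acyclic.\<close>

lemma acyclic_quiver: "acyclic_quiver V Q"
proof -
  have "distinct (z0 # (b @ c) @ [z1])" using dist by auto
  then obtain f :: "'v \<Rightarrow> real" where "sorted_wrt (\<lambda>i j. f i < f j) (z0 # (b @ c) @ [z1])"
    by (rule obtain_increasing)
  then have "\<forall>(u, v)\<in>Q. f u < f v"
    unfolding increasing_iff by (auto simp: sorted_wrt_append)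
  then have "orient (underlying_graph Q) f = Q"
    by (intro orient_eq_quiver) auto
  then have "acyclic Q"
    using acyclic_orient by metis
  moreover have "Q \<subseteq> V \<times> V"
    using path_arcs_subset[of "z0 # b @ [z1]"] path_arcs_subset[of "z0 # c @ [z1]"]
    unfolding Q_def V_def by auto
  ultimately show ?thesis
    unfolding acyclic_quiver_def V_def by simp
qed

text \<open>Converse of \<open>shuffle_increasing\<close>: the chains put \<open>z1\<close> on top,
  hence last, and filtering the other letters gives back \<open>b\<close> and
  \<open>c\<close>.\<close>

lemma increasing_word:
  fixes f :: "'v \<Rightarrow> real"
  assumes srt: "sorted_wrt (\<lambda>i j. f i < f j) (z0 # u)" and set: "set (z0 # u) = V"
    and dist_u: "distinct (z0 # u)" and inc: "\<forall>(u, v)\<in>Q. f u < f v"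
  obtains a where "a \<in> shuffles b c" "u = a @ [z1]"
proof -
  have setu: "set u = insert z1 (set b \<union> set c)"
    using set dist_u dist unfolding V_def by auto
  have below: "f v < f z1" if "v \<in> set b \<union> set c" for v
    using that inc unfolding increasing_iff by (auto simp: sorted_wrt_append)
  obtain a y where u: "u = a @ [y]"
    using setu by (cases u rule: rev_cases) auto
  have "y = z1"
  proof (rule ccontr)
    assume "y \<noteq> z1"
    then have "z1 \<in> set a" using setu u by auto
    then have "f z1 < f y" using srt u by (auto simp: sorted_wrt_append)
    moreover have "f y < f z1" using below setu u \<open>y \<noteq> z1\<close> by auto
    ultimately show False by simp
  qed
  have seta: "set a = set b \<union> set c"
    using setu u \<open>y = z1\<close> dist dist_u by auto
  have srta: "sorted_wrt (\<lambda>i j. f i < f j) a"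
    using srt u by (simp add: sorted_wrt_append)
  have srtbc: "sorted_wrt (\<lambda>i j. f i < f j) b" "sorted_wrt (\<lambda>i j. f i < f j) c"
    using inc unfolding increasing_iff by (auto simp: sorted_wrt_append)
  have "filter (\<lambda>v. v \<in> set b) a = b" "filter (\<lambda>v. v \<in> set c) a = c"
    using seta srta srtbc by (auto intro!: sorted_wrt_filter_eq)
  moreover have "filter (\<lambda>v. v \<notin> set b) a = filter (\<lambda>v. v \<in> set c) a"
    using seta dist by (intro filter_cong) auto
  ultimately have "a \<in> shuffles b c"
    using partition_in_shuffles[of a "\<lambda>v. v \<in> set b"] by simp
  then show thesis
    using that u \<open>y = z1\<close> by simp
qed

text \<open>If \<open>z0\<close> comes first, the arc from \<open>z0\<close> to \<open>z1\<close> keeps its direction, so the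
  potential takes equal values at both ends; being monotone along the two chains it is
  constant, and no arc is reversed.\<close>

lemma orient_in_toric_poset_increasing:
  fixes f :: "'v \<Rightarrow> real"
  assumes mem: "orient (underlying_graph Q) f \<in> toric_poset V Q" and first: "f z0 < f z1"
  shows "\<forall>(u, v)\<in>Q. f u < f v"
proof -
  obtain h :: "'v \<Rightarrow> int" where h: "\<And>u v. (u, v) \<in> Q \<Longrightarrow>
      ((u, v) \<in> orient (underlying_graph Q) f \<and> h v = h u) \<or>
      ((v, u) \<in> orient (underlying_graph Q) f \<and> h v = h u - 1)"
    using toric_poset_potential[OF acyclic_quiver mem] by blast
  have eq: "h z1 = h z0"
    using h[of z0 z1] first by (auto simp: Q_def orient_def)
  have const: "h v = h z0" if "v \<in> set (z0 # w @ [z1])" "path_arcs (z0 # w @ [z1]) \<subseteq> Q" for v w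
  proof -
    have "\<forall>(u, v)\<in>path_arcs (z0 # w @ [z1]). h u \<ge> h v"
      using h that(2) by fastforce
    then have "sorted_wrt (\<lambda>u v. h u \<ge> h v) (z0 # w @ [z1])"
      by (subst sorted_wrt_iff_path_arcs) (auto intro: transpI)
    then show ?thesis
      using that(1) eq by (fastforce simp: sorted_wrt_append)
  qed
  have "h v = h z0" if "v \<in> V" for v
    using that const[of v b] const[of v c] unfolding V_def Q_def by auto
  then have "h u = h v" if "(u, v) \<in> Q" for u v
    using that acyclic_quiver unfolding acyclic_quiver_def by (metis SigmaD1 SigmaD2 subsetD)
  then show ?thesis
    using h by (fastforce simp: orient_def)
qed

text \<open>The coordinates of a point of the chamber sort some rotation of the word, so
  \<open>orient_rotate_in_toric_poset\<close> applies; being pairwise distinct, they keep the point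
  off the arrangement.\<close>

lemma total_order_chamber_subset:
  assumes a: "a \<in> shuffles b c"
  shows "total_order_chamber V (toric_order (z0 # a @ [z1])) \<subseteq> toric_chamber V (toric_poset V Q)"
proof
  let ?w = "z0 # a @ [z1]"
  fix p assume p: "p \<in> total_order_chamber V (toric_order ?w)"
  then obtain m where pt: "p \<in> torus V" and inj: "inj_on (coord p) V"
    and srt: "sorted_wrt (\<lambda>i j. coord p i < coord p j) (rotate m ?w)"
    by (auto simp: total_order_chamber_def toric_order_def)
  have graph: "toric_graph (toric_poset V Q) = underlying_graph Q"
    by (rule toric_graph_eq[OF acyclic_quiver])
  have w: "set ?w = V" "distinct ?w"
    using set_shuffles[OF a] distinct_disjoint_shuffles[OF _ _ _ a] dist
    unfolding V_def by auto
  have "orient (underlying_graph Q) (coord p) \<in> toric_poset V Q"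
    by (rule orient_rotate_in_toric_poset[OF acyclic_quiver w _ srt])
      (use shuffle_increasing[OF a] in \<open>auto intro!: orient_eq_quiver\<close>)
  moreover have "p \<notin> toric_arrangement V (underlying_graph Q)"
  proof
    assume "p \<in> toric_arrangement V (underlying_graph Q)"
    then obtain i j x where ij: "{i, j} \<in> underlying_graph Q"
      and x: "x \<in> V \<rightarrow>\<^sub>E UNIV" "x i = x j" "p = torus_proj V x"
      by (auto simp: toric_arrangement_def)
    have "i \<in> V" "j \<in> V" "i \<noteq> j"
      using ij acyclic_quiver
      unfolding acyclic_quiver_def acyclic_def mem_underlying_graph by blast+
    then show False
      using inj x coord_torus_proj[OF x(1)] by (metis inj_onD)
  qed
  ultimately show "p \<in> toric_chamber V (toric_poset V Q)"
    using pt by (simp add: toric_chamber_def graph orientation_at_eq)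
qed

text \<open>One point suffices: its coordinates increase along \<open>z0 # u\<close>, so
  \<open>z0\<close> lies below \<open>z1\<close> and no arc of \<open>Q\<close> is reversed.\<close>

lemma shuffle_of_total_order_chamber_subset:
  assumes u: "set (z0 # u) = V" "distinct (z0 # u)"
    and sub: "total_order_chamber V (toric_order (z0 # u)) \<subseteq> toric_chamber V (toric_poset V Q)"
  obtains a where "a \<in> shuffles b c" "u = a @ [z1]"
proof -
  obtain f :: "'v \<Rightarrow> real" where f: "sorted_wrt (\<lambda>i j. f i < f j) (z0 # u)"
    "\<And>v. v \<in> set (z0 # u) \<Longrightarrow> 0 \<le> f v \<and> f v < 1"
    using obtain_increasing[OF u(2)] by blast
  \<comment> \<open>Representatives of torus points must be \<open>undefined\<close> outside
    \<open>V\<close>.\<close>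
  define g where "g = restrict f V"
  have g: "g \<in> V \<rightarrow>\<^sub>E UNIV" by (simp add: g_def)
  define p where "p = torus_proj V g"
  have coord: "coord p v = f v" if "v \<in> V" for v
    using that f(2)[of v] coord_torus_proj[OF g that]
    unfolding u(1) p_def g_def by (simp add: frac_eq)
  have "p \<in> torus V"
    using g unfolding p_def torus_proj_def torus_def by (rule quotientI)
  moreover have srt: "sorted_wrt (\<lambda>i j. coord p i < coord p j) (z0 # u)"
    using f(1) u(1) by (auto simp: coord intro: sorted_wrt_mono_rel[rotated])
  moreover have "inj_on (coord p) V"
  proof -
    have "distinct (map (coord p) (z0 # u))"
      using srt by (metis sorted_wrt_map strict_sorted_iff)
    then show ?thesis using u(1) by (metis distinct_map)
  qed
  ultimately have "p \<in> total_order_chamber V (toric_order (z0 # u))"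
    using u toric_order_self[of "z0 # u"]
    by (auto simp: total_order_chamber_def permutations_of_set_def intro!: bexI[of _ "z0 # u"])
  then have "orient (underlying_graph Q) (coord p) \<in> toric_poset V Q"
    using sub by (auto simp: toric_chamber_def orientation_at_eq toric_graph_eq[OF acyclic_quiver])
  moreover have "z1 \<in> set u" using u(1) dist unfolding V_def by auto
  then have "coord p z0 < coord p z1"
    using srt by simp
  ultimately have "\<forall>(u, v)\<in>Q. coord p u < coord p v"
    by (rule orient_in_toric_poset_increasing)
  then show thesis
    by (rule increasing_word[OF srt u]) (rule that)
qed

lemma toric_total_extensions_eq:
  "toric_total_extensions V (toric_poset V Q) = (\<lambda>a. toric_order (z1 # z0 # a)) ` shuffles b c"
proof (intro equalityI subsetI)
  fix W assume W: "W \<in> toric_total_extensions V (toric_poset V Q)"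
  then obtain w where w: "set w = V" "distinct w" "W = toric_order w"
    by (auto simp: toric_total_extensions_def toric_total_orders_def permutations_of_set_def)
  \<comment> \<open>Cutting at \<open>z0\<close> selects the representative of the class that starts
    with \<open>z0\<close>.\<close>
  have "z0 \<in> set w" using w(1) by (simp add: V_def)
  then obtain w1 w2 where split: "w = w1 @ z0 # w2" by (auto simp: in_set_conv_decomp)
  define u where "u = w2 @ w1"
  have "rotate (length w1) w = z0 # u"
    by (simp add: split u_def rotate_append)
  then have W_eq: "W = toric_order (z0 # u)"
    using w(3) toric_order_rotate by metis
  have u: "set (z0 # u) = V" "distinct (z0 # u)"
    using w unfolding split u_def by auto
  obtain a where "a \<in> shuffles b c" "u = a @ [z1]"
    using shuffle_of_total_order_chamber_subset[OF u] W
    unfolding W_eq toric_total_extensions_def by blast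
  then show "W \<in> (\<lambda>a. toric_order (z1 # z0 # a)) ` shuffles b c"
    using W_eq toric_order_Cons[of z1 "z0 # a"] by auto
next
  fix W assume "W \<in> (\<lambda>a. toric_order (z1 # z0 # a)) ` shuffles b c"
  then obtain a where a: "a \<in> shuffles b c" "W = toric_order (z0 # a @ [z1])"
    using toric_order_Cons[of z1] by auto
  have "set (z0 # a @ [z1]) = V" "distinct (z0 # a @ [z1])"
    using set_shuffles[OF a(1)] distinct_disjoint_shuffles[OF _ _ _ a(1)] dist
    unfolding V_def by auto
  then show "W \<in> toric_total_extensions V (toric_poset V Q)"
    using total_order_chamber_subset[OF a(1)] a(2)
    by (auto simp: toric_total_extensions_def toric_total_orders_def permutations_of_set_def)
qed

text \<open>Different shuffles give different classes, so the sum can be reindexed.\<close>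

lemma psi_tor_eq_sum_shuffles:
  "psi_tor x V (toric_poset V Q) = (\<Sum>a\<in>shuffles b c. psi_tor_order x (toric_order (z1 # z0 # a)))"
proof -
  have "inj_on (\<lambda>a. toric_order (z1 # z0 # a)) (shuffles b c)"
  proof (rule inj_onI)
    fix a a' assume a: "a \<in> shuffles b c" and eq: "toric_order (z1 # z0 # a) = toric_order (z1 # z0 # a')"
    have "distinct (z1 # z0 # a)"
      using set_shuffles[OF a] distinct_disjoint_shuffles[OF _ _ _ a] dist by auto
    then show "a = a'"
      using toric_order_Cons_eqD[OF _ eq] by simp
  qed
  then show ?thesis
    by (simp add: psi_tor_def toric_total_extensions_eq sum.reindex)
qed

text \<open>Closing the word adds the factor \<open>x z1 - x z0\<close> to the denominator; up to
  sign it cancels the numerator \<open>x z0 - x z1\<close> of the shuffle identity.\<close>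

lemma sum_shuffles_psi:
  fixes x :: "'v \<Rightarrow> 'f::field"
  assumes "inj_on x V"
  shows "(\<Sum>a\<in>shuffles b c. psi_tor_order x (toric_order (z1 # z0 # a)))
      = - 1 / (path_prod x (z0 # b @ [z1]) * path_prod x (z0 # c @ [z1]))"
proof -
  have ne: "x z1 - x z0 \<noteq> 0"
    using assms dist unfolding V_def by (auto simp: inj_on_def)
  have "(\<Sum>a\<in>shuffles b c. psi_tor_order x (toric_order (z1 # z0 # a)))
      = (\<Sum>a\<in>shuffles b c. 1 / path_prod x (z0 # a @ [z1])) / (x z1 - x z0)"
    by (simp add: psi_tor_order_eq psi_word_eq_path_prod sum_divide_distrib mult.commute)
  also have "(\<Sum>a\<in>shuffles b c. 1 / path_prod x (z0 # a @ [z1]))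
      = (x z0 - x z1) / (path_prod x (z0 # b @ [z1]) * path_prod x (z0 # c @ [z1]))"
    using assms dist unfolding V_def by (intro sum_shuffles_path_prod) auto
  also have "x z0 - x z1 = - 1 * (x z1 - x z0)" by simp
  also have "- 1 * (x z1 - x z0) / (path_prod x (z0 # b @ [z1]) * path_prod x (z0 # c @ [z1])) / (x z1 - x z0)
      = - 1 / (path_prod x (z0 # b @ [z1]) * path_prod x (z0 # c @ [z1]))"
    using ne by (simp del: mult_minus_left minus_diff_eq)
  finally show ?thesis .
qed

end

theorem corollary1p7:
  fixes z0 z1 :: "'v::linorder"
    and b c bb cc :: "'v list"
    and k j :: nat
    and V :: "'v set"
    and Q :: "'v rel"
    and x :: "'v \<Rightarrow> ('v, 'k::field) ratfun"
  assumes "k \<ge> 1" and "j \<ge> 1"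
    and "length b = k" and "length c = j"
    and "distinct (z0 # z1 # b @ c)"
    and "V = set (z0 # z1 # b @ c)"
    and "bb = z0 # b @ [z1]"
    and "cc = z0 # c @ [z1]"
    and "Q = {(bb ! r, bb ! Suc r) | r. r \<le> k} \<union> {(cc ! s, cc ! Suc s) | s. s \<le> j} \<union> {(z0, z1)}"
    and "x = indet"
  shows "psi_tor x V (toric_poset V Q) =
           (-1) ^ k / ((\<Prod>r=0..k. (x (bb ! Suc r) - x (bb ! r))) *
                       (\<Prod>s=0..j. (x (cc ! s) - x (cc ! Suc s))))
       \<and> (\<Sum>a\<in>shuffles b c. psi_tor_order x (toric_order (z1 # z0 # a))) =
           (-1) ^ k * psi_tor_order x (toric_order (z1 # rev b @ z0 # c))"
proof -
  have len: "length bb = k + 2" "length cc = j + 2"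
    using assms by simp_all
  \<comment> \<open>Since \<open>bb\<close> has length \<open>k + 2\<close>, the bound
    \<open>r \<le> k\<close> is \<open>Suc r < length bb\<close>; likewise for
    \<open>cc\<close>.\<close>
  interpret double_chain z0 z1 b c V Q
    using assms len by unfold_locales (auto simp: path_arcs_def less_Suc_eq_le)
  have inj: "inj_on x V"
    using inj_indet inj_on_subset assms(10) by blast
  let ?P = "path_prod x bb" and ?R = "path_prod x cc"
  have sum: "(\<Sum>a\<in>shuffles b c. psi_tor_order x (toric_order (z1 # z0 # a))) = - 1 / (?P * ?R)"
    using sum_shuffles_psi[OF inj] assms by simp
  have *: "(-1) ^ k / ((-1) ^ Suc k * ?P * ?R) = - 1 / (?P * ?R)"
    by simp
  \<comment> \<open>There are \<open>k + 1\<close> factors, each the negative of a factor of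
    \<open>?P\<close>.\<close>
  have "(\<Prod>r=0..k. (x (bb ! Suc r) - x (bb ! r))) = (\<Prod>r<Suc k. - 1 * (x (bb ! r) - x (bb ! Suc r)))"
    by (intro prod.cong) auto
  also have "\<dots> = (-1) ^ Suc k * ?P"
    unfolding prod.distrib path_prod_def len by simp
  finally have b_prod: "(\<Prod>r=0..k. (x (bb ! Suc r) - x (bb ! r))) = (-1) ^ Suc k * ?P" .
  have c_prod: "(\<Prod>s=0..j. (x (cc ! s) - x (cc ! Suc s))) = ?R"
    unfolding path_prod_def len by (intro prod.cong) auto
  \<comment> \<open>Closed up at \<open>z1\<close>, the cyclic word is \<open>rev bb\<close>
    followed by \<open>cc\<close>, glued at \<open>z0\<close>; reversing \<open>bb\<close> gives the
    sign \<open>(-1) ^ Suc k\<close> again.\<close>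
  have "path_prod x (z1 # rev b @ z0 # c @ [z1]) = path_prod x (rev bb) * ?R"
    using path_prod_append[of x "z1 # rev b" z0 "c @ [z1]"] assms by simp
  then have "psi_tor_order x (toric_order (z1 # rev b @ z0 # c)) = 1 / ((-1) ^ Suc k * ?P * ?R)"
    using len by (simp add: psi_tor_order_eq psi_word_eq_path_prod path_prod_rev)
  then show ?thesis
    unfolding psi_tor_eq_sum_shuffles sum b_prod c_prod using * by simp
qed

end
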